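(* Let $([0,1],\bigvee,*,1)$ be a left-continuous $t$-norm. Let $\varphi:[0,1]\to[0,1]$ be a lower-semicontinuous function satisfying $\varphi(t)>t$ for all $0<t<1$, and $\varphi(1)=1$. Suppose that $(P,[\![\cdot\le\cdot]\!])$ is a (Cauchy-)complete fuzzy preorder with respect to $*$, and that $f:P\to P$ is a function such that $[\![fx\le fy]\!]\ge\varphi([\![x\le y]\!])$ for all $x,y\in P$. If there exists $x\in P$ such that $[\![x\le fx]\!]\neq 0\neq[\![fx\le x]\!]$, then the sequence $(f^n(x))_{n\in\mathbb{N}}$ converges to a fixpoint of $f$.
   Context: A left-continuous $t$-norm is a commutative monoid operation $*$ on $[0,1]$ with unit $1$ that distributes over arbitrary suprema in each variable (i.e. a commutative integral quantale on $[0,1]$). A fuzzy preorder (with respect to $*$) is a set $P$ with a map $P\times P\to[0,1]$, $(x,y)\mapsto[\![x\le y]\!]$, such that $[\![x\le y]\!]*[\![y\le z]\!]\le[\![x\le z]\!]$ and $[\![x\le x]\!]=1$ for all $x,y,z$. A sequence $(x_n)$ in $P$ is Cauchy if $\sup_N\inf_{n,m\ge N}[\![x_n\le x_m]\!]=1$; it converges to $u\in P$ if for all $y\in P$, $[\![y\le u]\!]=\sup_N\inf_{n\ge N}[\![y\le x_n]\!]$ and $[\![u\le y]\!]=\sup_N\inf_{n\ge N}[\![x_n\le y]\!]$. $P$ is (Cauchy-)complete if every Cauchy sequence converges; equivalently, in enriched terms, whenever $\phi,\psi:P\to[0,1]$ satisfy $[\![y'\le y]\!]*\phi(y)\le\phi(y')$,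 $\psi(y)*[\![y\le y']\!]\le\psi(y')$, $\sup_y\psi(y)*\phi(y)=1$ and $\phi(y)*\psi(y')\le[\![y\le y']\!]$ for all $y,y'$, there is $u\in P$ with $\phi(y)=[\![y\le u]\!]$ for all $y$. A fixpoint of $f$ is a $u\in P$ with $[\![fu\le u]\!]=1=[\![u\le fu]\!]$. A function $\varphi:L\to M$ between complete lattices is lower-semicontinuous if for every net $(t_i)_{i\in I}$ in $L$ (a family indexed by a directed poset $I$), $\varphi(\bigvee_i\bigwedge_{j\ge i}t_j)\le\bigvee_i\bigwedge_{j\ge i}\varphi(t_j)$. *)

theory Defs
  imports Complex_Main "HOL-Library.FuncSet"
begin

typedef unit_interval = "{0..1::real}"
  by (rule exI[of _ 0]) simp

instantiation unit_interval :: zero_neq_one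
begin

definition zero_unit_interval_def: "0 = Abs_unit_interval 0"
definition one_unit_interval_def: "1 = Abs_unit_interval 1"

instance
  by standard (simp add: zero_unit_interval_def one_unit_interval_def Abs_unit_interval_inject)

end

lemma Rep_unit_interval_0 [simp]: "Rep_unit_interval 0 = 0"
  by (simp add: zero_unit_interval_def Abs_unit_interval_inverse)

lemma Rep_unit_interval_1 [simp]: "Rep_unit_interval 1 = 1"
  by (simp add: one_unit_interval_def Abs_unit_interval_inverse)

lemma Rep_unit_interval_bounds: "0 \<le> Rep_unit_interval x" "Rep_unit_interval x \<le> 1"
  using Rep_unit_interval[of x] by auto

instantiation unit_interval :: linorder
begin

definition less_eq_unit_interval where
  "x \<le> y \<longleftrightarrow> Rep_unit_interval x \<le> Rep_unit_interval y"
definition less_unit_interval where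
  "x < y \<longleftrightarrow> Rep_unit_interval x < Rep_unit_interval y"

instance
  by standard
    (auto simp: less_eq_unit_interval_def less_unit_interval_def Rep_unit_interval_inject)

end

instantiation unit_interval :: complete_linorder
begin

definition inf_unit_interval :: "unit_interval \<Rightarrow> unit_interval \<Rightarrow> unit_interval" where
  "inf_unit_interval = min"
definition sup_unit_interval :: "unit_interval \<Rightarrow> unit_interval \<Rightarrow> unit_interval" where
  "sup_unit_interval = max"
definition bot_unit_interval :: unit_interval where "bot_unit_interval = 0"
definition top_unit_interval :: unit_interval where "top_unit_interval = 1"

text \<open>Inserting the bounds gives \<open>Sup {} = 0\<close> and \<open>Inf {} = 1\<close>, and changes
  nothing on nonempty sets.\<close>

definition Sup_unit_interval where
  "Sup A = Abs_unit_interval (Sup (insert 0 (Rep_unit_interval ` A)))"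
definition Inf_unit_interval where
  "Inf A = Abs_unit_interval (Inf (insert 1 (Rep_unit_interval ` A)))"

instance
proof
  fix x y z :: unit_interval and A :: "unit_interval set"
  let ?R = "Rep_unit_interval"
  have bdd: "bdd_above (insert 0 (?R ` A))" "bdd_below (insert 1 (?R ` A))"
    by (auto intro!: bdd_aboveI[of _ 1] bdd_belowI[of _ 0] simp: Rep_unit_interval_bounds)
  have "0 \<le> Sup (insert 0 (?R ` A))" "Inf (insert 1 (?R ` A)) \<le> 1"
    using bdd by (auto intro: cSup_upper cInf_lower)
  moreover have "Sup (insert 0 (?R ` A)) \<le> 1" "0 \<le> Inf (insert 1 (?R ` A))"
    by (auto intro!: cSup_least cInf_greatest simp: Rep_unit_interval_bounds)
  ultimately have RSup: "?R (Sup A) = Sup (insert 0 (?R ` A))"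
    and RInf: "?R (Inf A) = Inf (insert 1 (?R ` A))"
    by (simp_all add: Sup_unit_interval_def Inf_unit_interval_def Abs_unit_interval_inverse)
  show "inf x y \<le> x" "inf x y \<le> y" "x \<le> sup x y" "y \<le> sup x y"
    by (auto simp: inf_unit_interval_def sup_unit_interval_def min_def max_def)
  show "x \<le> inf y z" if "x \<le> y" "x \<le> z"
    using that by (auto simp: inf_unit_interval_def min_def)
  show "sup y z \<le> x" if "y \<le> x" "z \<le> x"
    using that by (auto simp: sup_unit_interval_def max_def)
  show "Inf A \<le> x" if "x \<in> A"
    unfolding less_eq_unit_interval_def RInf using that bdd by (auto intro: cInf_lower)
  show "x \<le> Sup A" if "x \<in> A"
    unfolding less_eq_unit_interval_def RSup using that bdd by (auto intro: cSup_upper)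
  show "z \<le> Inf A" if "\<And>x. x \<in> A \<Longrightarrow> z \<le> x"
    unfolding less_eq_unit_interval_def RInf
    using that by (intro cInf_greatest) (auto simp: less_eq_unit_interval_def Rep_unit_interval_bounds)
  show "Sup A \<le> z" if "\<And>x. x \<in> A \<Longrightarrow> x \<le> z"
    unfolding less_eq_unit_interval_def RSup
    using that by (intro cSup_least) (auto simp: less_eq_unit_interval_def Rep_unit_interval_bounds)
  show "Inf {} = (top :: unit_interval)"
    by (simp add: Inf_unit_interval_def top_unit_interval_def one_unit_interval_def)
  show "Sup {} = (bot :: unit_interval)"
    by (simp add: Sup_unit_interval_def bot_unit_interval_def zero_unit_interval_def)
qed

end

definition left_continuous_tnorm ::
    "(unit_interval \<Rightarrow> unit_interval \<Rightarrow> unit_interval) \<Rightarrow> bool" where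
  "left_continuous_tnorm T \<longleftrightarrow>
     comm_monoid T 1 \<and>
     (\<forall>a B. T a (Sup B) = (SUP b\<in>B. T a b)) \<and>
     (\<forall>A b. T (Sup A) b = (SUP a\<in>A. T a b))"

definition directed_poset :: "'i set \<Rightarrow> ('i \<times> 'i) set \<Rightarrow> bool" where
  "directed_poset I r \<longleftrightarrow>
     partial_order_on I r \<and> I \<noteq> {} \<and>
     (\<forall>i\<in>I. \<forall>j\<in>I. \<exists>k\<in>I. (i, k) \<in> r \<and> (j, k) \<in> r)"

definition net_liminf :: "'i set \<Rightarrow> ('i \<times> 'i) set \<Rightarrow> ('i \<Rightarrow> 'a::complete_lattice) \<Rightarrow> 'a" where
  "net_liminf I r t = (SUP i\<in>I. INF j\<in>{j\<in>I. (i, j) \<in> r}. t j)"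

text \<open>A definition cannot quantify over all index types. The index type below is large
  enough to reindex any net in \<open>'a\<close> without changing its tails, so the condition covers
  nets over arbitrary index types; this is the lemma \<open>lower_semicontinuousD\<close>.\<close>

definition lower_semicontinuous :: "('a::complete_lattice \<Rightarrow> 'b::complete_lattice) \<Rightarrow> bool" where
  "lower_semicontinuous \<phi> \<longleftrightarrow>
     (\<forall>(I :: ('a set \<times> 'a \<times> nat) set) r t. directed_poset I r \<longrightarrow>
        \<phi> (net_liminf I r t) \<le> net_liminf I r (\<lambda>i. \<phi> (t i)))"

lemma lower_semicontinuousD:
  fixes \<phi> :: "'a::complete_lattice \<Rightarrow> 'b::complete_lattice" and I :: "'i set"
  assumes lsc: "lower_semicontinuous \<phi>" and dir: "directed_poset I r"
  shows "\<phi> (net_liminf I r t) \<le> net_liminf I r (\<lambda>i. \<phi> (t i))"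
proof -
  define tail where "tail i = t ` {j\<in>I. (i, j) \<in> r}" for i
  define J where "J = {(S, x, n :: nat). (\<exists>i\<in>I. S = tail i) \<and> x \<in> S}"
  define q where "q = {(p, p'). p \<in> J \<and> p' \<in> J \<and>
    (p = p' \<or> fst p' \<subseteq> fst p \<and> snd (snd p) < snd (snd p'))}"
  have refl: "(i, i) \<in> r" if "i \<in> I" for i
    using dir that by (auto simp: directed_poset_def partial_order_on_def preorder_on_def refl_on_def)
  have trans: "(i, k) \<in> r" if "(i, j) \<in> r" "(j, k) \<in> r" for i j k
    using dir that unfolding directed_poset_def partial_order_on_def preorder_on_def
    by (meson transD)
  have tail_mem: "t i \<in> tail i" if "i \<in> I" for i
    using refl that by (auto simp: tail_def)
  have tail_mono: "tail j \<subseteq> tail i" if "(i, j) \<in> r" for i j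
    using trans that by (auto simp: tail_def)
  have "directed_poset J q"
    unfolding directed_poset_def
  proof (intro conjI ballI)
    show "partial_order_on J q"
      unfolding partial_order_on_def preorder_on_def
      by (auto simp: q_def refl_on_def trans_def antisym_def)
    obtain i where "i \<in> I"
      using dir by (auto simp: directed_poset_def)
    then have "(tail i, t i, 0) \<in> J"
      using tail_mem by (auto simp: J_def)
    then show "J \<noteq> {}"
      by blast
    fix p p' assume J: "p \<in> J" "p' \<in> J"
    obtain i x n where p: "p = (tail i, x, n)" "i \<in> I" "x \<in> tail i"
      using J by (auto simp: J_def)
    obtain i' x' n' where p': "p' = (tail i', x', n')" "i' \<in> I" "x' \<in> tail i'"
      using J by (auto simp: J_def)
    obtain k where k: "k \<in> I" "(i, k) \<in> r" "(i', k) \<in> r"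
      using dir p p' unfolding directed_poset_def by blast
    have "(tail k, t k, Suc (max n n')) \<in> J"
      using k tail_mem by (auto simp: J_def)
    then show "\<exists>k\<in>J. (p, k) \<in> q \<and> (p', k) \<in> q"
      using J p(1) p'(1) tail_mono[OF k(2)] tail_mono[OF k(3)]
      by (intro bexI[of _ "(tail k, t k, Suc (max n n'))"]) (simp_all add: q_def less_Suc_eq_le)
  qed
  have reindex: "net_liminf J q (\<lambda>p. g (fst (snd p))) = net_liminf I r (\<lambda>i. g (t i))"
    for g :: "'a \<Rightarrow> 'c::complete_lattice"
  proof -
    have inf_eq: "(INF p'\<in>{p'\<in>J. (p, p') \<in> q}. g (fst (snd p'))) = Inf (g ` fst p)"
      if p: "p \<in> J" for p
    proof -
      have "(\<lambda>p'. g (fst (snd p'))) ` {p'\<in>J. (p, p') \<in> q} = g ` fst p" (is "?L = ?R")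
      proof
        show "?L \<subseteq> ?R"
          using p by (auto simp: q_def J_def)
        show "?R \<subseteq> ?L"
        proof
          fix y assume "y \<in> ?R"
          then obtain z where z: "z \<in> fst p" "y = g z" by blast
          have "(fst p, z, Suc (snd (snd p))) \<in> {p'\<in>J. (p, p') \<in> q}"
            using p z by (auto simp: q_def J_def)
          then show "y \<in> ?L"
            using z(2) by force
        qed
      qed
      then show ?thesis by simp
    qed
    have fstJ: "fst ` J = tail ` I"
    proof
      show "fst ` J \<subseteq> tail ` I" by (auto simp: J_def)
      show "tail ` I \<subseteq> fst ` J"
      proof
        fix S assume "S \<in> tail ` I"
        then obtain i where "i \<in> I" "S = tail i" by blast
        then have "(S, t i, 0) \<in> J" using tail_mem by (auto simp: J_def)
        then show "S \<in> fst ` J" by force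
      qed
    qed
    have "net_liminf J q (\<lambda>p. g (fst (snd p))) = (SUP p\<in>J. Inf (g ` fst p))"
      unfolding net_liminf_def by (intro SUP_cong HOL.refl inf_eq)
    also have "\<dots> = (SUP S\<in>fst ` J. Inf (g ` S))"
      by (simp add: image_image)
    also have "\<dots> = net_liminf I r (\<lambda>i. g (t i))"
      unfolding fstJ net_liminf_def by (simp add: image_image tail_def)
    finally show ?thesis .
  qed
  have "\<phi> (net_liminf J q (\<lambda>p. fst (snd p))) \<le> net_liminf J q (\<lambda>p. \<phi> (fst (snd p)))"
    using lsc \<open>directed_poset J q\<close> unfolding lower_semicontinuous_def by blast
  then show ?thesis
    using reindex[of "\<lambda>x. x"] reindex[of \<phi>] by simp
qed

definition fuzzy_preorder ::
    "(unit_interval \<Rightarrow> unit_interval \<Rightarrow> unit_interval) \<Rightarrow> 'p set \<Rightarrow>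
     ('p \<Rightarrow> 'p \<Rightarrow> unit_interval) \<Rightarrow> bool" where
  "fuzzy_preorder T P le \<longleftrightarrow>
     (\<forall>x\<in>P. \<forall>y\<in>P. \<forall>z\<in>P. T (le x y) (le y z) \<le> le x z) \<and>
     (\<forall>x\<in>P. le x x = 1)"

definition fuzzy_Cauchy :: "('p \<Rightarrow> 'p \<Rightarrow> unit_interval) \<Rightarrow> (nat \<Rightarrow> 'p) \<Rightarrow> bool" where
  "fuzzy_Cauchy le X \<longleftrightarrow> (SUP N. INF (n, m)\<in>{N..} \<times> {N..}. le (X n) (X m)) = 1"

definition fuzzy_converges ::
    "'p set \<Rightarrow> ('p \<Rightarrow> 'p \<Rightarrow> unit_interval) \<Rightarrow> (nat \<Rightarrow> 'p) \<Rightarrow> 'p \<Rightarrow> bool" where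
  "fuzzy_converges P le X u \<longleftrightarrow> u \<in> P \<and>
     (\<forall>y\<in>P. le y u = (SUP N. INF n\<in>{N..}. le y (X n)) \<and>
             le u y = (SUP N. INF n\<in>{N..}. le (X n) y))"

definition fuzzy_complete :: "'p set \<Rightarrow> ('p \<Rightarrow> 'p \<Rightarrow> unit_interval) \<Rightarrow> bool" where
  "fuzzy_complete P le \<longleftrightarrow>
     (\<forall>X. range X \<subseteq> P \<longrightarrow> fuzzy_Cauchy le X \<longrightarrow> (\<exists>u. fuzzy_converges P le X u))"

definition fuzzy_fixpoint ::
    "'p set \<Rightarrow> ('p \<Rightarrow> 'p \<Rightarrow> unit_interval) \<Rightarrow> ('p \<Rightarrow> 'p) \<Rightarrow> 'p \<Rightarrow> bool" where
  "fuzzy_fixpoint P le f u \<longleftrightarrow> u \<in> P \<and> le (f u) u = 1 \<and> le u (f u) = 1"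

end

theory Submission
  imports Defs "HOL-Library.Liminf_Limsup"
begin

text \<open>
  Lower semicontinuity makes \<open>\<phi>\<close> monotone and gives
  \<open>\<phi> (liminf t) \<le> liminf (\<phi> \<circ> t)\<close> for sequences. Write \<open>x\<^sub>n\<close> for \<open>f\<^sup>n x\<close>.

  The degrees \<open>a\<^sub>n = le x\<^sub>n x\<^sub>n\<^sub>+\<^sub>1\<close> satisfy \<open>\<phi> a\<^sub>n \<le> a\<^sub>n\<^sub>+\<^sub>1\<close>, so they increase from \<open>a\<^sub>0 > 0\<close>, and
  their limit \<open>L > 0\<close> satisfies \<open>\<phi> L \<le> L\<close>; hence \<open>L = 1\<close>
  (\<open>liminf_eq_1_of_comparison\<close>).

  For the Cauchy property, let \<open>0 < e < 1\<close>. Since \<open>\<phi> e > e\<close>, left continuity of \<open>T\<close> gives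
  \<open>d < 1\<close> with \<open>T d (\<phi> e) > e\<close>. Once all \<open>a\<^sub>n\<close> are at least \<open>d\<close>, the bound
  \<open>e \<le> le x\<^sub>n x\<^sub>m\<close> propagates in \<open>m\<close> through
  \<open>le x\<^sub>n x\<^sub>m\<^sub>+\<^sub>1 \<ge> T a\<^sub>n (le x\<^sub>n\<^sub>+\<^sub>1 x\<^sub>m\<^sub>+\<^sub>1) \<ge> T d (\<phi> e)\<close> (\<open>orbit_forward_bound\<close>). The indices
  \<open>n > m\<close> are covered by the same argument in the opposite preorder, which starts from
  \<open>le (f x) x > 0\<close>.

  Finally, if \<open>x\<^sub>n\<close> converges to \<open>u\<close>, then \<open>le u x\<^sub>n\<close> and \<open>le x\<^sub>n u\<close> have lower limit 1, hence
  so have \<open>le (f u) x\<^sub>n\<^sub>+\<^sub>1\<close> and \<open>le x\<^sub>n\<^sub>+\<^sub>1 (f u)\<close>. These lower limits are \<open>le (f u) u\<close> and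
  \<open>le u (f u)\<close>, so \<open>u\<close> is a fixpoint.
\<close>

section \<open>Order and lower limits in the unit interval\<close>

lemma unit_interval_ge_0 [simp]: "(0 :: unit_interval) \<le> t"
  and unit_interval_le_1 [simp]: "t \<le> (1 :: unit_interval)"
  by (simp_all add: less_eq_unit_interval_def Rep_unit_interval_bounds)

lemma unit_interval_1_le_iff [simp]: "(1 :: unit_interval) \<le> t \<longleftrightarrow> t = 1"
  by (metis unit_interval_le_1 order.antisym order.refl)

lemma unit_interval_pos_iff: "(0 :: unit_interval) < t \<longleftrightarrow> t \<noteq> 0"
  by (metis unit_interval_ge_0 order.not_eq_order_implies_strict order.irrefl)

instance unit_interval :: dense_linorder
proof
  fix s t :: unit_interval
  assume "s < t"
  then obtain r where r: "Rep_unit_interval s < r" "r < Rep_unit_interval t"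
    using dense by (auto simp: less_unit_interval_def)
  then have "r \<in> {0..1}"
    using Rep_unit_interval_bounds(1)[of s] Rep_unit_interval_bounds(2)[of t] by simp
  with r show "\<exists>z. s < z \<and> z < t"
    by (intro exI[of _ "Abs_unit_interval r"])
       (simp add: less_unit_interval_def Abs_unit_interval_inverse)
qed

lemma liminf_Suc:
  fixes X :: "nat \<Rightarrow> 'a::complete_lattice"
  shows "liminf (\<lambda>n. X (Suc n)) = liminf X"
proof -
  have "filtermap Suc sequentially = sequentially"
    by (simp add: filter_eq_iff eventually_filtermap)
  then show ?thesis
    using Liminf_filtermap_eq[of Suc sequentially X] by simp
qed

section \<open>Lower semicontinuous gain functions\<close>

lemma lower_semicontinuous_liminf:
  fixes t :: "nat \<Rightarrow> 'a::complete_lattice" and \<phi> :: "'a \<Rightarrow> 'b::complete_lattice"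
  assumes "lower_semicontinuous \<phi>"
  shows "\<phi> (liminf t) \<le> liminf (\<lambda>n. \<phi> (t n))"
proof -
  have "directed_poset UNIV {(m, n :: nat). m \<le> n}"
    by (auto simp: directed_poset_def partial_order_on_def preorder_on_def
        intro!: refl_onI transI antisymI intro: max.cobounded1 max.cobounded2)
  from lower_semicontinuousD[OF assms this, of t] show ?thesis
    by (simp add: net_liminf_def liminf_SUP_INF atLeast_def)
qed

text \<open>The sequence that alternates between \<open>s \<le> t\<close> has lower limit \<open>s\<close>, while the lower limit
  of its image is at most \<open>\<phi> t\<close>.\<close>

lemma lower_semicontinuous_mono:
  fixes \<phi> :: "'a::complete_lattice \<Rightarrow> 'b::complete_lattice"
  assumes "lower_semicontinuous \<phi>"
  shows "mono \<phi>"
proof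
  fix s t :: 'a
  assume "s \<le> t"
  define X where "X n = (if even n then s else t)" for n :: nat
  have "s \<le> liminf X"
    by (intro Liminf_bounded) (simp add: X_def \<open>s \<le> t\<close>)
  moreover have "liminf X \<le> s"
  proof -
    have "(INF m\<in>{n..}. X m) \<le> s" for n
      by (rule INF_lower2[of "2 * n"]) (auto simp: X_def)
    then show ?thesis
      unfolding liminf_SUP_INF by (intro SUP_least)
  qed
  ultimately have "liminf X = s"
    by (rule antisym[rotated])
  then have "\<phi> s \<le> liminf (\<lambda>n. \<phi> (X n))"
    using lower_semicontinuous_liminf[OF assms, of X] by simp
  also have "\<dots> \<le> \<phi> t"
  proof -
    have "(INF m\<in>{n..}. \<phi> (X m)) \<le> \<phi> t" for n
      by (rule INF_lower2[of "Suc (2 * n)"]) (auto simp: X_def)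
    then show ?thesis
      unfolding liminf_SUP_INF by (intro SUP_least)
  qed
  finally show "\<phi> s \<le> \<phi> t" .
qed

text \<open>The lower limit \<open>L\<close> of the sequence is a point with \<open>\<phi> L \<le> L\<close>, and \<open>L \<ge> a 0 > 0\<close> because
  the sequence increases. The gain condition leaves only \<open>L = 1\<close>.\<close>

lemma liminf_eq_1_of_comparison:
  fixes a :: "nat \<Rightarrow> unit_interval"
  assumes lsc: "lower_semicontinuous \<phi>"
    and gain: "\<And>t. 0 < t \<Longrightarrow> t < 1 \<Longrightarrow> t < \<phi> t"
    and one: "\<phi> 1 = 1"
    and step: "\<And>n. \<phi> (a n) \<le> a (Suc n)"
    and pos: "0 < a 0"
  shows "liminf a = 1"
proof -
  have "t \<le> \<phi> t" for t
    using gain[of t] one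
    by (metis unit_interval_pos_iff unit_interval_ge_0 unit_interval_le_1
        order.strict_iff_order)
  then have "a n \<le> a (Suc n)" for n
    using step order.trans by blast
  then have "a 0 \<le> a n" for n
    by (rule lift_Suc_mono_le) simp
  then have "a 0 \<le> liminf a"
    by (intro Liminf_bounded) simp
  moreover have "\<phi> (liminf a) \<le> liminf a"
  proof -
    have "\<phi> (liminf a) \<le> liminf (\<lambda>n. \<phi> (a n))"
      by (rule lower_semicontinuous_liminf[OF lsc])
    also have "\<dots> \<le> liminf (\<lambda>n. a (Suc n))"
      by (intro Liminf_mono) (simp add: step)
    finally show ?thesis
      by (simp add: liminf_Suc)
  qed
  ultimately show ?thesis
    using gain[of "liminf a"] pos
    by (metis unit_interval_le_1 order.strict_trans2 order.strict_iff_order leD)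
qed

section \<open>Left-continuous t-norms\<close>

lemma left_continuous_tnorm_commute:
  "left_continuous_tnorm T \<Longrightarrow> T a b = T b a"
  unfolding left_continuous_tnorm_def
  by (meson abel_semigroup.commute comm_monoid.axioms(1))

lemma left_continuous_tnorm_mono:
  assumes T: "left_continuous_tnorm T" and "a \<le> a'" "b \<le> b'"
  shows "T a b \<le> T a' b'"
proof -
  have right: "T c d \<le> T c d'" if "d \<le> d'" for c d d'
  proof -
    have "T c (Sup {d, d'}) = (SUP b\<in>{d, d'}. T c b)"
      using T unfolding left_continuous_tnorm_def by blast
    then have "T c d' = sup (T c d) (T c d')"
      using that by (simp add: sup.absorb2)
    then show ?thesis
      by (metis sup_ge1)
  qed
  have "T a b \<le> T a b'"
    by (rule right) fact
  also have "\<dots> = T b' a"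
    by (rule left_continuous_tnorm_commute[OF T])
  also have "\<dots> \<le> T b' a'"
    by (rule right) fact
  also have "\<dots> = T a' b'"
    by (rule left_continuous_tnorm_commute[OF T])
  finally show ?thesis .
qed

text \<open>As 1 is the supremum of the elements below it, \<open>c = T 1 c\<close> is the supremum of the
  elements \<open>T d c\<close> with \<open>d < 1\<close>.\<close>

lemma left_continuous_tnorm_approx_unit:
  assumes T: "left_continuous_tnorm T" and "e < c"
  obtains d where "d < 1" "e < T d c"
proof -
  have "T 1 c = c"
    using T unfolding left_continuous_tnorm_def by (simp add: comm_monoid.comm_neutral
        left_continuous_tnorm_commute[OF T, of 1])
  moreover have "T (Sup {..<1}) c = (SUP d\<in>{..<1}. T d c)"
    using T unfolding left_continuous_tnorm_def by blast
  ultimately have "e < (SUP d\<in>{..<1}. T d c)"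
    using \<open>e < c\<close> by simp
  then show ?thesis
    using that by (auto simp: less_SUP_iff)
qed

section \<open>Fuzzy preorders and their opposites\<close>

lemma fuzzy_preorder_opposite:
  assumes "left_continuous_tnorm T" "fuzzy_preorder T P le"
  shows "fuzzy_preorder T P (\<lambda>x y. le y x)"
  using assms(2) left_continuous_tnorm_commute[OF assms(1)]
  unfolding fuzzy_preorder_def by metis

lemma fuzzy_converges_opposite:
  "fuzzy_converges P (\<lambda>x y. le y x) X u \<longleftrightarrow> fuzzy_converges P le X u"
  unfolding fuzzy_converges_def by auto

lemma fuzzy_convergesD:
  assumes "fuzzy_converges P le X u"
  shows "u \<in> P" and "y \<in> P \<Longrightarrow> le y u = liminf (\<lambda>n. le y (X n))"
  using assms by (simp_all add: fuzzy_converges_def liminf_SUP_INF)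

lemma funpow_mem:
  "f \<in> P \<rightarrow> P \<Longrightarrow> x \<in> P \<Longrightarrow> (f ^^ n) x \<in> P"
  by (induction n) auto

section \<open>Orbits of a gaining map\<close>

text \<open>Degrees between consecutive orbit points satisfy the comparison hypothesis, so for \<open>d\<close>
  with \<open>e < T d (\<phi> e)\<close> they eventually exceed \<open>d\<close>. From there on the bound \<open>e\<close> reproduces
  itself along the orbit.\<close>

lemma orbit_forward_bound:
  assumes T: "left_continuous_tnorm T"
    and lsc: "lower_semicontinuous \<phi>"
    and gain: "\<And>t. 0 < t \<Longrightarrow> t < 1 \<Longrightarrow> t < \<phi> t"
    and one: "\<phi> 1 = 1"
    and P: "fuzzy_preorder T P le"
    and f: "f \<in> P \<rightarrow> P"
    and expand: "\<And>x y. x \<in> P \<Longrightarrow> y \<in> P \<Longrightarrow> \<phi> (le x y) \<le> le (f x) (f y)"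
    and x: "x \<in> P" and pos: "le x (f x) \<noteq> 0"
    and e: "e < 1"
  shows "\<exists>N. \<forall>n\<ge>N. \<forall>m\<ge>n. e \<le> le ((f ^^ n) x) ((f ^^ m) x)"
proof (cases "e = 0")
  case True
  then show ?thesis by simp
next
  case False
  let ?X = "\<lambda>n. (f ^^ n) x"
  have X: "?X n \<in> P" for n
    using f x by (rule funpow_mem)
  have "e < \<phi> e"
    using gain e False by (simp add: unit_interval_pos_iff)
  then obtain d where d: "d < 1" "e < T d (\<phi> e)"
    by (rule left_continuous_tnorm_approx_unit[OF T])
  have "liminf (\<lambda>n. le (?X n) (?X (Suc n))) = 1"
  proof (rule liminf_eq_1_of_comparison[OF lsc gain one])
    show "\<phi> (le (?X n) (?X (Suc n))) \<le> le (?X (Suc n)) (?X (Suc (Suc n)))" for n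
      using expand[OF X[of n] X[of "Suc n"]] by simp
    show "0 < le (?X 0) (?X (Suc 0))"
      using pos by (simp add: unit_interval_pos_iff)
  qed
  then have "\<forall>\<^sub>F n in sequentially. d < le (?X n) (?X (Suc n))"
    using d(1) by (intro less_LiminfD) simp
  then obtain N where N: "\<And>n. n \<ge> N \<Longrightarrow> d < le (?X n) (?X (Suc n))"
    by (auto simp: eventually_sequentially)
  have "e \<le> le (?X n) (?X m)" if "n \<ge> N" "m \<ge> n" for n m
    using that(2)
  proof (induction m rule: dec_induct)
    case base
    show ?case
      using P X[of n] by (simp add: fuzzy_preorder_def)
  next
    case (step m)
    have "\<phi> e \<le> \<phi> (le (?X n) (?X m))"
      using lower_semicontinuous_mono[OF lsc] step.IH by (rule monoD)
    also have "\<dots> \<le> le (?X (Suc n)) (?X (Suc m))"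
      using expand[OF X[of n] X[of m]] by simp
    finally have "T d (\<phi> e) \<le> T (le (?X n) (?X (Suc n))) (le (?X (Suc n)) (?X (Suc m)))"
      using N[OF that(1)] by (intro left_continuous_tnorm_mono[OF T]) auto
    also have "\<dots> \<le> le (?X n) (?X (Suc m))"
      using P X unfolding fuzzy_preorder_def by blast
    finally show ?case
      using d(2) by simp
  qed
  then show ?thesis by blast
qed

lemma orbit_fuzzy_Cauchy:
  assumes T: "left_continuous_tnorm T"
    and lsc: "lower_semicontinuous \<phi>"
    and gain: "\<And>t. 0 < t \<Longrightarrow> t < 1 \<Longrightarrow> t < \<phi> t"
    and one: "\<phi> 1 = 1"
    and P: "fuzzy_preorder T P le"
    and f: "f \<in> P \<rightarrow> P"
    and expand: "\<And>x y. x \<in> P \<Longrightarrow> y \<in> P \<Longrightarrow> \<phi> (le x y) \<le> le (f x) (f y)"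
    and x: "x \<in> P" and pos: "le x (f x) \<noteq> 0" "le (f x) x \<noteq> 0"
  shows "fuzzy_Cauchy le (\<lambda>n. (f ^^ n) x)"
proof -
  let ?X = "\<lambda>n. (f ^^ n) x"
  have "\<exists>N. e \<le> (INF (n, m)\<in>{N..} \<times> {N..}. le (?X n) (?X m))" if e: "e < 1" for e
  proof -
    obtain N\<^sub>1 where N\<^sub>1: "\<And>n m. n \<ge> N\<^sub>1 \<Longrightarrow> m \<ge> n \<Longrightarrow> e \<le> le (?X n) (?X m)"
      using orbit_forward_bound[where le = le, OF T lsc gain one P f expand x pos(1) e] by auto
    obtain N\<^sub>2 where N\<^sub>2: "\<And>n m. n \<ge> N\<^sub>2 \<Longrightarrow> m \<ge> n \<Longrightarrow> e \<le> le (?X m) (?X n)"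
      using orbit_forward_bound[where le = "\<lambda>x y. le y x", OF T lsc gain one
          fuzzy_preorder_opposite[OF T P] f expand x pos(2) e]
      by auto
    have "e \<le> le (?X n) (?X m)" if "n \<ge> max N\<^sub>1 N\<^sub>2" "m \<ge> max N\<^sub>1 N\<^sub>2" for n m
      using that N\<^sub>1[of n m] N\<^sub>2[of m n] by (cases "n \<le> m") simp_all
    then have "e \<le> (INF (n, m)\<in>{max N\<^sub>1 N\<^sub>2..} \<times> {max N\<^sub>1 N\<^sub>2..}. le (?X n) (?X m))"
      by (intro INF_greatest) auto
    then show ?thesis ..
  qed
  then have "1 \<le> (SUP N. INF (n, m)\<in>{N..} \<times> {N..}. le (?X n) (?X m))"
    unfolding le_Sup_iff_less by auto
  then show ?thesis
    by (simp add: fuzzy_Cauchy_def)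
qed

text \<open>Convergence gives \<open>le u x\<^sub>n\<close> the lower limit \<open>le u u = 1\<close>; \<open>\<phi>\<close> carries this to
  \<open>le (f u) x\<^sub>n\<^sub>+\<^sub>1\<close>, whose lower limit is \<open>le (f u) u\<close>.\<close>

lemma orbit_limit_prefixpoint:
  assumes lsc: "lower_semicontinuous \<phi>"
    and one: "\<phi> 1 = 1"
    and P: "fuzzy_preorder T P le"
    and f: "f \<in> P \<rightarrow> P"
    and expand: "\<And>x y. x \<in> P \<Longrightarrow> y \<in> P \<Longrightarrow> \<phi> (le x y) \<le> le (f x) (f y)"
    and x: "x \<in> P"
    and conv: "fuzzy_converges P le (\<lambda>n. (f ^^ n) x) u"
  shows "le (f u) u = 1"
proof -
  let ?X = "\<lambda>n. (f ^^ n) x"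
  have u: "u \<in> P" "f u \<in> P"
    using fuzzy_convergesD(1)[OF conv] f by auto
  have "liminf (\<lambda>n. le u (?X n)) = 1"
    using P u(1) fuzzy_convergesD(2)[OF conv u(1)] by (simp add: fuzzy_preorder_def)
  then have "1 \<le> liminf (\<lambda>n. \<phi> (le u (?X n)))"
    using lower_semicontinuous_liminf[OF lsc, of "\<lambda>n. le u (?X n)"] one by simp
  also have "\<dots> \<le> liminf (\<lambda>n. le (f u) (?X (Suc n)))"
    using expand[OF u(1) funpow_mem[OF f x]] by (intro Liminf_mono) simp
  also have "\<dots> = le (f u) u"
    unfolding fuzzy_convergesD(2)[OF conv u(2)] by (rule liminf_Suc)
  finally show ?thesis by simp
qed

theorem corollary3p3p1:
  fixes T :: "unit_interval \<Rightarrow> unit_interval \<Rightarrow> unit_interval"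
    and \<phi> :: "unit_interval \<Rightarrow> unit_interval"
    and P :: "'p set"
    and le :: "'p \<Rightarrow> 'p \<Rightarrow> unit_interval"
    and f :: "'p \<Rightarrow> 'p"
    and x :: 'p
  assumes "left_continuous_tnorm T"
    and "lower_semicontinuous \<phi>"
    and "\<And>t. 0 < t \<Longrightarrow> t < 1 \<Longrightarrow> \<phi> t > t"
    and "\<phi> 1 = 1"
    and "fuzzy_preorder T P le"
    and "fuzzy_complete P le"
    and "f \<in> P \<rightarrow> P"
    and "\<And>x y. x \<in> P \<Longrightarrow> y \<in> P \<Longrightarrow> le (f x) (f y) \<ge> \<phi> (le x y)"
    and "x \<in> P"
    and "le x (f x) \<noteq> 0"
    and "le (f x) x \<noteq> 0"
  shows "\<exists>u. fuzzy_fixpoint P le f u \<and> fuzzy_converges P le (\<lambda>n. (f ^^ n) x) u"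
proof -
  note expand = assms(8)
  have "range (\<lambda>n. (f ^^ n) x) \<subseteq> P"
    using funpow_mem[OF assms(7,9)] by blast
  moreover have "fuzzy_Cauchy le (\<lambda>n. (f ^^ n) x)"
    by (rule orbit_fuzzy_Cauchy[OF assms(1,2,3,4,5,7) expand assms(9,10,11)])
  ultimately obtain u where u: "fuzzy_converges P le (\<lambda>n. (f ^^ n) x) u"
    using assms(6) unfolding fuzzy_complete_def by blast
  have "le (f u) u = 1"
    by (rule orbit_limit_prefixpoint[OF assms(2,4,5,7) expand assms(9) u])
  moreover have "le u (f u) = 1"
    by (rule orbit_limit_prefixpoint[where le = "\<lambda>x y. le y x", OF assms(2,4)
          fuzzy_preorder_opposite[OF assms(1,5)] assms(7) expand assms(9)
          fuzzy_converges_opposite[THEN iffD2, OF u]])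
  ultimately show ?thesis
    using u fuzzy_convergesD(1)[OF u] unfolding fuzzy_fixpoint_def by blast
qed

end
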